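(* Let $\Gamma$ be the hexagonal (honeycomb) lattice graph and $\Gamma_0$ its edge graph, regarded as an infinite union of hexagons $\{H_j\}$, each vertex belonging to exactly two hexagons. For a hexagon $H$ let $\psi_H:\Gamma_0\to\mathbb R$ take alternating values $\pm1$ around the six vertices of $H$ and vanish elsewhere. Let $E_6$ be the space of $u\in\ell^2(\Gamma_0)$ with $-\Delta_{\Gamma_0}u=6u$. Suppose $u\in E_6$ has compact (i.e. finite) support. Then $u=\sum_jc_j\psi_{H_j}$, a finite sum.
   Context: $\Gamma$ is the $3$-regular graph whose vertices and edges are those of the tiling of the plane by regular hexagons. The edge graph $\Gamma_0$ has the edges of $\Gamma$ as vertices, two being adjacent iff they share an endpoint (it is $4$-regular; it is the kagome lattice). The hexagons of $\Gamma_0$ are the $6$-cycles formed by the six edges bounding a hexagonal face of $\Gamma$; the triangles of $\Gamma_0$ correspond to the vertices of $\Gamma$. $\Delta_{\Gamma_0}u(x)=\sum_{y\sim x}(u(y)-u(x))$. *)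

theory Defs
  imports "HOL-Analysis.Analysis"
begin

text \<open>
  The tiling of the plane by regular hexagons with unit sides: tile \<open>(m, n)\<close> has its corners on
  the unit circle around its centre, and neighbouring centres are at distance \<open>sqrt 3\<close>.
\<close>

definition hex_centre :: "int \<times> int \<Rightarrow> complex" where
  "hex_centre = (\<lambda>(m, n). of_real (sqrt 3) * (of_int m * cis (pi / 6) + of_int n * cis (pi / 2)))"

definition hex_corner :: "int \<times> int \<Rightarrow> nat \<Rightarrow> complex" where
  "hex_corner j k = hex_centre j + cis (real k * (pi / 3))"

text \<open>The index \<open>k\<close> is read modulo 6; the six sides of a tile are those with \<open>k < 6\<close>.\<close>

definition hex_side :: "int \<times> int \<Rightarrow> nat \<Rightarrow> complex set" where
  "hex_side j k = {hex_corner j k, hex_corner j (Suc k)}"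

text \<open>
  The edges of the honeycomb graph \<open>\<Gamma>\<close>, each given by its two endpoints. An edge is a side of two
  tiles and occurs only once in this set. These edges are the vertices of \<open>\<Gamma>\<^sub>0\<close>.
\<close>

definition honeycomb_edges :: "complex set set" where
  "honeycomb_edges = {hex_side j k | j k. k < 6}"

text \<open>
  Functions on \<open>\<Gamma>\<^sub>0\<close> are functions on \<^typ>\<open>complex set\<close> of which only the values on
  \<^const>\<open>honeycomb_edges\<close> matter. Scalars are kept general to cover both real and complex \<open>\<ell>\<^sup>2\<close>.
\<close>

definition edge_adj :: "'v set \<Rightarrow> 'v set \<Rightarrow> bool" where
  "edge_adj e f \<longleftrightarrow> e \<noteq> f \<and> e \<inter> f \<noteq> {}"

definition laplacian :: "(complex set \<Rightarrow> 'k::real_normed_field) \<Rightarrow> complex set \<Rightarrow> 'k" where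
  "laplacian u x = (\<Sum>y\<in>{y \<in> honeycomb_edges. edge_adj x y}. u y - u x)"

definition E6 :: "(complex set \<Rightarrow> 'k::real_normed_field) set" where
  "E6 = {u. (\<lambda>x. (norm (u x))\<^sup>2) summable_on honeycomb_edges \<and>
            (\<forall>x\<in>honeycomb_edges. - laplacian u x = 6 * u x)}"

definition psi :: "int \<times> int \<Rightarrow> complex set \<Rightarrow> real" where
  "psi j e = (if e \<in> hex_side j ` {0, 2, 4} then 1
              else if e \<in> hex_side j ` {1, 3, 5} then - 1
              else 0)"

end

theory Submission
  imports Defs
begin

text \<open>
  Write \<open>T v\<close> for the sum of \<open>u\<close> over the three edges at a vertex \<open>v\<close> of \<open>\<Gamma>\<close>. Each end of an edge
  \<open>x\<close> lies on two of the four neighbours of \<open>x\<close>, so \<open>\<Delta>u(x) = T v + T w - 6 u(x)\<close> when \<open>x\<close> joins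
  \<open>v\<close> and \<open>w\<close>. Hence \<open>-\<Delta>u = 6u\<close> says exactly that \<open>T\<close> changes sign across every edge. Then \<open>T\<close> is
  constant along a row of vertices two steps apart, and finite support forces \<open>T = 0\<close>.

  Now pass to the dual triangular lattice, whose points are the tiles \<open>(m, n)\<close>. An edge of \<open>\<Gamma>\<close>
  separates two tiles, and on it \<open>\<Sum>j. c j * psi j\<close> is, up to a sign that depends only on the
  direction of the edge, the difference of \<open>c\<close> over the two tiles. So with these signs \<open>u\<close> becomes
  a 1-form on the triangular lattice. The vertices of \<open>\<Gamma>\<close> are the triangles, \<open>T = 0\<close> says
  that the form is closed, and the assertion is that it is the gradient of a finitely supported
  function: the compactly supported cohomology of the plane vanishes in degree one. The third
  direction of the triangular lattice is determined by the other two, which leaves the statement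
  \<open>finitely_supported_potential\<close> about the square lattice.
\<close>

section \<open>Finitely supported potentials on the square lattice\<close>

lemma finite_int_pairs_bounded:
  fixes S :: "(int \<times> int) set"
  assumes "finite S"
  obtains N where "\<And>m n. (m, n) \<in> S \<Longrightarrow> \<bar>m\<bar> \<le> N \<and> \<bar>n\<bar> \<le> N"
proof -
  have "finite ((\<lambda>(m, n). max \<bar>m\<bar> \<bar>n\<bar>) ` S)" using assms by simp
  then have "bdd_above ((\<lambda>(m, n). max \<bar>m\<bar> \<bar>n\<bar>) ` S)" by (rule bdd_above_finite)
  then obtain N where N: "\<And>x. x \<in> (\<lambda>(m, n). max \<bar>m\<bar> \<bar>n\<bar>) ` S \<Longrightarrow> x \<le> N"
    by (auto simp: bdd_above_def)
  show thesis
  proof (rule that)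
    fix m n assume "(m, n) \<in> S"
    then have "max \<bar>m\<bar> \<bar>n\<bar> \<le> N" by (intro N) force
    then show "\<bar>m\<bar> \<le> N \<and> \<bar>n\<bar> \<le> N" by simp
  qed
qed

lemma shift_invariant_imp_constant:
  fixes g :: "int \<Rightarrow> 'a"
  assumes "\<And>m. g (m + 1) = g m"
  shows "g m = g m'"
proof -
  have "g k = g 0" for k
  proof (induction k rule: int_induct[where k = 0])
    case (step2 i)
    then show ?case using assms[of "i - 1"] by simp
  qed (simp_all add: assms)
  then show ?thesis by metis
qed

text \<open>
  Summing \<open>p\<close> along the ray to the right gives a potential for \<open>p\<close> that vanishes to the right, above
  and below the support. Its vertical differences agree with \<open>q\<close> because, by closedness, the error
  is constant along rows and vanishes far to the right. To the left of the support
  the potential is constant on each column, as \<open>q\<close> vanishes there, and so it is zero.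
\<close>

lemma finitely_supported_potential:
  fixes p q :: "int \<Rightarrow> int \<Rightarrow> 'a::ab_group_add"
  assumes finp: "finite {(m, n). p m n \<noteq> 0}" and finq: "finite {(m, n). q m n \<noteq> 0}"
    and closed: "\<And>m n. p m n + q (m + 1) n = q m n + p m (n + 1)"
  obtains c where "finite {(m, n). c m n \<noteq> 0}"
    "\<And>m n. c m n - c (m + 1) n = p m n" "\<And>m n. c m n - c m (n + 1) = q m n"
proof -
  have "finite ({(m, n). p m n \<noteq> 0} \<union> {(m, n). q m n \<noteq> 0})" using finp finq by simp
  then obtain N where N: "\<And>m n. (m, n) \<in> {(m, n). p m n \<noteq> 0} \<union> {(m, n). q m n \<noteq> 0}
      \<Longrightarrow> \<bar>m\<bar> \<le> N \<and> \<bar>n\<bar> \<le> N"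
    by (rule finite_int_pairs_bounded) (rule that)
  then have p0: "p m n = 0" and q0: "q m n = 0" if "m > N \<or> m < - N \<or> n > N \<or> n < - N" for m n
  proof -
    have "\<not> (\<bar>m\<bar> \<le> N \<and> \<bar>n\<bar> \<le> N)" using that by linarith
    then have "(m, n) \<notin> {(m, n). p m n \<noteq> 0} \<union> {(m, n). q m n \<noteq> 0}"
      using N by blast
    then show "p m n = 0" "q m n = 0" by simp_all
  qed
  define c where "c m n = (\<Sum>i = m..N. p i n)" for m n
  have c_right: "c m n = 0" if "m > N" for m n
    using that by (simp add: c_def)
  have c_rows: "c m n = 0" if "n > N \<or> n < - N" for m n
    using that by (auto simp: c_def p0)
  have c_p: "c m n - c (m + 1) n = p m n" for m n
  proof (cases "m \<le> N")
    case True
    then have "{m..N} = insert m {m + 1..N}" by auto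
    then show ?thesis by (simp add: c_def)
  next
    case False
    then show ?thesis by (simp add: c_right p0)
  qed
  have c_q: "c m n - c m (n + 1) = q m n" for m n
  proof -
    define g where "g m = c m n - c m (n + 1) - q m n" for m
    have "g (m + 1) = g m" for m
    proof -
      have "g (m + 1) - g m = (c m (n + 1) - c (m + 1) (n + 1)) - (c m n - c (m + 1) n)
          - q (m + 1) n + q m n"
        by (simp add: g_def algebra_simps)
      also have "\<dots> = (q m n + p m (n + 1)) - (p m n + q (m + 1) n)"
        unfolding c_p by (simp add: algebra_simps)
      also have "\<dots> = 0" by (simp only: closed diff_self)
      finally show ?thesis by simp
    qed
    then have "g m = g (N + 1)" by (rule shift_invariant_imp_constant)
    also have "\<dots> = 0" unfolding g_def by (simp add: c_right q0)
    finally show ?thesis by (simp add: g_def)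
  qed
  have c_left: "c m n = 0" if "m < - N" for m n
  proof -
    have "c m (k + 1) = c m k" for k
      using c_q[of m k] q0[of m k] that by simp
    then have "c m n = c m (N + 1)" by (rule shift_invariant_imp_constant)
    then show ?thesis by (simp add: c_rows)
  qed
  have "- N \<le> m \<and> m \<le> N \<and> - N \<le> n \<and> n \<le> N" if "c m n \<noteq> 0" for m n
    using that c_left[of m n] c_right[of m n] c_rows[of n m] by linarith
  then have "{(m, n). c m n \<noteq> 0} \<subseteq> {- N..N} \<times> {- N..N}" by auto
  then have "finite {(m, n). c m n \<noteq> 0}" by (rule finite_subset) simp
  then show thesis using c_p c_q that by blast
qed

section \<open>Coordinates on the honeycomb\<close>

lemma sqrt3_mult_sqrt3: "sqrt 3 * (sqrt 3 * x) = 3 * (x::real)"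
  by (simp flip: mult.assoc)

lemma cis_multiples_of_pi_third:
  "cis (real 0 * (pi / 3)) = Complex 1 0"
  "cis (real 1 * (pi / 3)) = Complex (1 / 2) (sqrt 3 / 2)"
  "cis (real 2 * (pi / 3)) = Complex (- (1 / 2)) (sqrt 3 / 2)"
  "cis (real 3 * (pi / 3)) = Complex (- 1) 0"
  "cis (real 4 * (pi / 3)) = Complex (- (1 / 2)) (- (sqrt 3 / 2))"
  "cis (real 5 * (pi / 3)) = Complex (1 / 2) (- (sqrt 3 / 2))"
  "cis (real 6 * (pi / 3)) = Complex 1 0"
proof -
  have 1: "cis (real 1 * (pi / 3)) = Complex (1 / 2) (sqrt 3 / 2)"
    by (simp add: complex_eq_iff cos_60 sin_60)
  have 2: "cis (real 2 * (pi / 3)) = Complex (- (1 / 2)) (sqrt 3 / 2)"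
    by (simp add: complex_eq_iff cos_120 sin_120)
  have 3: "cis (real 3 * (pi / 3)) = Complex (- 1) 0"
    by (simp add: complex_eq_iff)
  have shift: "cis (real (k + 3) * (pi / 3)) = - cis (real k * (pi / 3))" for k
    by (simp add: complex_eq_iff distrib_right add_divide_distrib)
  show "cis (real 0 * (pi / 3)) = Complex 1 0" by (simp add: complex_eq_iff)
  show "cis (real 1 * (pi / 3)) = Complex (1 / 2) (sqrt 3 / 2)" by (fact 1)
  show "cis (real 2 * (pi / 3)) = Complex (- (1 / 2)) (sqrt 3 / 2)" by (fact 2)
  show "cis (real 3 * (pi / 3)) = Complex (- 1) 0" by (fact 3)
  show "cis (real 4 * (pi / 3)) = Complex (- (1 / 2)) (- (sqrt 3 / 2))"
    using shift[of 1] 1 by (simp add: complex_eq_iff)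
  show "cis (real 5 * (pi / 3)) = Complex (1 / 2) (- (sqrt 3 / 2))"
    using shift[of 2] 2 by (simp add: complex_eq_iff)
  show "cis (real 6 * (pi / 3)) = Complex 1 0"
    using shift[of 3] 3 by (simp add: complex_eq_iff)
qed

lemma hex_centre_eq:
  "hex_centre (m, n) = Complex (3 / 2 * of_int m) (sqrt 3 * (of_int m / 2 + of_int n))"
  by (simp add: hex_centre_def complex_eq_iff cos_30 sin_30 algebra_simps sqrt3_mult_sqrt3)

text \<open>
  Each vertex of \<open>\<Gamma>\<close> is the corner 1 or the corner 2 of exactly one tile; these two kinds are
  the two classes of the bipartite graph \<open>\<Gamma>\<close>. Likewise each edge of \<open>\<Gamma>\<close> is the
  side 0, 1 or 2 of exactly one tile. All combinatorics is carried out in these normal forms.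
\<close>

definition va :: "int \<Rightarrow> int \<Rightarrow> complex" where
  "va m n = hex_corner (m, n) 1"

definition vb :: "int \<Rightarrow> int \<Rightarrow> complex" where
  "vb m n = hex_corner (m, n) 2"

lemma hex_corner_normal_form:
  "hex_corner (m, n) 1 = va m n"
  "hex_corner (m, n) 2 = vb m n"
  "hex_corner (m, n) 0 = vb (m + 1) (n - 1)"
  "hex_corner (m, n) 3 = va (m - 1) n"
  "hex_corner (m, n) 4 = vb m (n - 1)"
  "hex_corner (m, n) 5 = va m (n - 1)"
  "hex_corner (m, n) 6 = vb (m + 1) (n - 1)"
  unfolding va_def vb_def hex_corner_def cis_multiples_of_pi_third hex_centre_eq
  by (simp_all add: complex_eq_iff field_simps)

lemma va_eq_iff: "va m n = va m' n' \<longleftrightarrow> m = m' \<and> n = n'"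
  and vb_eq_iff: "vb m n = vb m' n' \<longleftrightarrow> m = m' \<and> n = n'"
  unfolding va_def vb_def hex_corner_def hex_centre_eq by (auto simp: complex_eq_iff)

text \<open>
  In units of one half the real parts of the two kinds of vertices are \<open>1\<close> and \<open>- 1\<close> modulo 3.
\<close>

lemma va_neq_vb: "va m n \<noteq> vb m' n'"
proof
  assume "va m n = vb m' n'"
  then have "real_of_int (3 * m + 1) = of_int (3 * m' - 1)"
    unfolding va_def vb_def hex_corner_def cis_multiples_of_pi_third hex_centre_eq
    by (simp add: complex_eq_iff field_simps)
  then have "3 * m + 1 = 3 * m' - 1" by (simp only: of_int_eq_iff)
  then show False by presburger
qed

lemmas vertex_eq_simps = va_eq_iff vb_eq_iff va_neq_vb va_neq_vb[symmetric]

definition e0 :: "int \<Rightarrow> int \<Rightarrow> complex set" where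
  "e0 m n = {vb (m + 1) (n - 1), va m n}"

definition e1 :: "int \<Rightarrow> int \<Rightarrow> complex set" where
  "e1 m n = {va m n, vb m n}"

definition e2 :: "int \<Rightarrow> int \<Rightarrow> complex set" where
  "e2 m n = {vb m n, va (m - 1) n}"

lemmas edge_defs = e0_def e1_def e2_def

lemma hex_side_normal_form:
  "hex_side (m, n) 0 = e0 m n"
  "hex_side (m, n) 1 = e1 m n"
  "hex_side (m, n) 2 = e2 m n"
  "hex_side (m, n) 3 = e0 (m - 1) n"
  "hex_side (m, n) 4 = e1 m (n - 1)"
  "hex_side (m, n) 5 = e2 (m + 1) (n - 1)"
proof -
  have suc: "Suc 0 = 1" "Suc 1 = 2" "Suc 2 = 3" "Suc 3 = 4" "Suc 4 = 5" "Suc 5 = 6" by simp_all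
  show "hex_side (m, n) 0 = e0 m n" "hex_side (m, n) 1 = e1 m n" "hex_side (m, n) 2 = e2 m n"
    "hex_side (m, n) 3 = e0 (m - 1) n" "hex_side (m, n) 4 = e1 m (n - 1)"
    "hex_side (m, n) 5 = e2 (m + 1) (n - 1)"
    unfolding hex_side_def suc hex_corner_normal_form edge_defs
    by (simp_all add: insert_commute)
qed

lemma honeycomb_edges_normal_form:
  "honeycomb_edges = {e. \<exists>m n. e = e0 m n \<or> e = e1 m n \<or> e = e2 m n}"
proof (intro set_eqI iffI)
  fix e assume "e \<in> honeycomb_edges"
  then obtain m n k where e: "e = hex_side (m, n) k" and "k < 6"
    unfolding honeycomb_edges_def by auto
  from \<open>k < 6\<close> have "k \<in> {0, 1, 2, 3, 4, 5}" by auto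
  then show "e \<in> {e. \<exists>m n. e = e0 m n \<or> e = e1 m n \<or> e = e2 m n}"
    unfolding e using hex_side_normal_form[of m n] by (elim insertE emptyE) blast+
next
  fix e assume "e \<in> {e. \<exists>m n. e = e0 m n \<or> e = e1 m n \<or> e = e2 m n}"
  then obtain m n where "e = hex_side (m, n) 0 \<or> e = hex_side (m, n) 1 \<or> e = hex_side (m, n) 2"
    unfolding hex_side_normal_form by blast
  moreover have "(0::nat) < 6" "(1::nat) < 6" "(2::nat) < 6" by simp_all
  ultimately show "e \<in> honeycomb_edges" unfolding honeycomb_edges_def by blast
qed

lemma edge_eq_simps:
  "e0 m n = e0 m' n' \<longleftrightarrow> m = m' \<and> n = n'"
  "e1 m n = e1 m' n' \<longleftrightarrow> m = m' \<and> n = n'"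
  "e2 m n = e2 m' n' \<longleftrightarrow> m = m' \<and> n = n'"
  "e0 m n \<noteq> e1 m' n'" "e0 m n \<noteq> e2 m' n'" "e1 m n \<noteq> e2 m' n'"
  "e1 m n \<noteq> e0 m' n'" "e2 m n \<noteq> e0 m' n'" "e2 m n \<noteq> e1 m' n'"
  unfolding edge_defs by (auto simp: doubleton_eq_iff vertex_eq_simps)

lemma vertex_mem_edge:
  "va k l \<in> e0 m n \<longleftrightarrow> m = k \<and> n = l"
  "va k l \<in> e1 m n \<longleftrightarrow> m = k \<and> n = l"
  "va k l \<in> e2 m n \<longleftrightarrow> m = k + 1 \<and> n = l"
  "vb k l \<in> e0 m n \<longleftrightarrow> m = k - 1 \<and> n = l + 1"
  "vb k l \<in> e1 m n \<longleftrightarrow> m = k \<and> n = l"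
  "vb k l \<in> e2 m n \<longleftrightarrow> m = k \<and> n = l"
  unfolding edge_defs by (auto simp: vertex_eq_simps)

lemma edge_mem [simp]:
  "e0 m n \<in> honeycomb_edges" "e1 m n \<in> honeycomb_edges" "e2 m n \<in> honeycomb_edges"
  unfolding honeycomb_edges_normal_form by blast+

lemma psi_edge:
  "psi j (e0 m n) = (if j = (m, n) then 1 else if j = (m + 1, n) then - 1 else 0)"
  "psi j (e1 m n) = (if j = (m, n) then - 1 else if j = (m, n + 1) then 1 else 0)"
  "psi j (e2 m n) = (if j = (m, n) then 1 else if j = (m - 1, n + 1) then - 1 else 0)"
  by (cases j; unfold psi_def image_insert image_empty;
      simp only: prod.case hex_side_normal_form insert_iff empty_iff edge_eq_simps prod.inject;
      auto)+

section \<open>The Laplacian and the sums at the vertices\<close>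

definition incident_edges :: "complex \<Rightarrow> complex set set" where
  "incident_edges v = {e \<in> honeycomb_edges. v \<in> e}"

lemma incident_edges_va: "incident_edges (va m n) = {e0 m n, e1 m n, e2 (m + 1) n}"
  and incident_edges_vb: "incident_edges (vb m n) = {e1 m n, e2 m n, e0 (m - 1) (n + 1)}"
  unfolding incident_edges_def honeycomb_edges_normal_form
  by (auto simp: vertex_mem_edge)

lemma card_incident_edges: "v \<in> e \<Longrightarrow> e \<in> honeycomb_edges \<Longrightarrow> card (incident_edges v) = 3"
proof -
  have "card (incident_edges (va m n)) = 3" "card (incident_edges (vb m n)) = 3" for m n
    unfolding incident_edges_va incident_edges_vb by (simp_all add: card_insert_if edge_eq_simps)
  then show "v \<in> e \<Longrightarrow> e \<in> honeycomb_edges \<Longrightarrow> card (incident_edges v) = 3"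
    unfolding honeycomb_edges_normal_form edge_defs by auto
qed

definition vertex_sum :: "(complex set \<Rightarrow> 'k::real_normed_field) \<Rightarrow> complex \<Rightarrow> 'k" where
  "vertex_sum u v = (\<Sum>e\<in>incident_edges v. u e)"

lemma vertex_sum_va: "vertex_sum u (va m n) = u (e0 m n) + u (e1 m n) + u (e2 (m + 1) n)"
  and vertex_sum_vb: "vertex_sum u (vb m n) = u (e1 m n) + u (e2 m n) + u (e0 (m - 1) (n + 1))"
  unfolding vertex_sum_def incident_edges_va incident_edges_vb
  by (simp_all add: edge_eq_simps)

text \<open>
  The edge \<open>{v, w}\<close> itself occurs once in each of the two vertex sums, which accounts for
  2 of the 6; the other 4 is its degree in \<open>\<Gamma>\<^sub>0\<close>.
\<close>

lemma laplacian_eq_vertex_sums: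
  assumes edge: "{v, w} \<in> honeycomb_edges" and "v \<noteq> w"
  shows "laplacian u {v, w} = vertex_sum u v + vertex_sum u w - 6 * u {v, w}"
proof -
  let ?x = "{v, w}"
  have card: "card (incident_edges v) = 3" "card (incident_edges w) = 3"
    using card_incident_edges[OF _ edge] by simp_all
  then have fin: "finite (incident_edges v)" "finite (incident_edges w)"
    by (metis card.infinite zero_neq_numeral)+
  have mem: "?x \<in> incident_edges v" "?x \<in> incident_edges w"
    using edge by (simp_all add: incident_edges_def)
  \<comment> \<open>An edge containing both ends of \<open>{v, w}\<close> equals it, so no neighbour is counted twice.\<close>
  have only: "e = ?x" if "e \<in> honeycomb_edges" "v \<in> e" "w \<in> e" for e
    using that \<open>v \<noteq> w\<close> unfolding honeycomb_edges_normal_form edge_defs by auto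
  have "{y \<in> honeycomb_edges. edge_adj ?x y}
      = (incident_edges v - {?x}) \<union> (incident_edges w - {?x})"
    by (auto simp: edge_adj_def incident_edges_def)
  moreover have "(incident_edges v - {?x}) \<inter> (incident_edges w - {?x}) = {}"
    using only by (auto simp: incident_edges_def)
  ultimately have "laplacian u ?x = (\<Sum>y\<in>incident_edges v - {?x}. u y - u ?x)
      + (\<Sum>y\<in>incident_edges w - {?x}. u y - u ?x)"
    unfolding laplacian_def using fin by (simp add: sum.union_disjoint)
  also have "\<dots> = (vertex_sum u v - u ?x - 2 * u ?x) + (vertex_sum u w - u ?x - 2 * u ?x)"
    using fin mem card by (simp add: sum_subtractf vertex_sum_def sum_diff1)
  finally show ?thesis by (simp add: algebra_simps)
qed

text \<open>
  Going from \<open>va m n\<close> to \<open>vb m n\<close> and on to \<open>va (m - 1) n\<close> changes the sign twice, so the vertex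
  sums at the vertices \<open>va m n\<close> of a row all agree.
\<close>

lemma vertex_sums_vanish:
  fixes u :: "complex set \<Rightarrow> 'k::real_normed_field"
  assumes eigen: "\<And>x. x \<in> honeycomb_edges \<Longrightarrow> - laplacian u x = 6 * u x"
    and fin: "finite {x \<in> honeycomb_edges. u x \<noteq> 0}"
  shows "vertex_sum u (va m n) = 0" "vertex_sum u (vb m n) = 0"
proof -
  have flip: "vertex_sum u v + vertex_sum u w = 0"
    if "{v, w} \<in> honeycomb_edges" "v \<noteq> w" for v w
    using eigen[OF that(1)] laplacian_eq_vertex_sums[OF that, of u] by (simp add: algebra_simps)
  have edges: "{va m n, vb m n} \<in> honeycomb_edges" "{vb m n, va (m - 1) n} \<in> honeycomb_edges" for m n
    using edge_mem(2,3)[of m n] by (simp_all add: edge_defs)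
  have ab: "vertex_sum u (vb m n) = - vertex_sum u (va m n)" for m n
    using flip[OF edges(1)[of m n]] by (simp add: vertex_eq_simps eq_neg_iff_add_eq_0 add.commute)
  have ba: "vertex_sum u (vb m n) = - vertex_sum u (va (m - 1) n)" for m n
    using flip[OF edges(2)[of m n]] by (simp add: vertex_eq_simps eq_neg_iff_add_eq_0)
  have shift: "vertex_sum u (va (m + 1) n) = vertex_sum u (va m n)" for m n
    using ab[of "m + 1" n] ba[of "m + 1" n] by simp
  have "\<exists>m'. vertex_sum u (va m' n) = 0"
  proof (rule ccontr)
    assume nz: "\<nexists>m'. vertex_sum u (va m' n) = 0"
    \<comment> \<open>Infinitely many vertices of the row would then be ends of edges in the support.\<close>
    let ?S = "{x \<in> honeycomb_edges. u x \<noteq> 0}"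
    have "va m' n \<in> \<Union>?S" for m'
    proof -
      have "\<exists>e\<in>incident_edges (va m' n). u e \<noteq> 0"
        using nz unfolding vertex_sum_def by (metis sum.neutral)
      then show ?thesis by (auto simp: incident_edges_def)
    qed
    then have "range (\<lambda>m'. va m' n) \<subseteq> \<Union>?S" by blast
    moreover have "finite (\<Union>?S)"
    proof (rule finite_Union[OF fin])
      fix e assume "e \<in> ?S"
      then show "finite e" unfolding honeycomb_edges_normal_form edge_defs by auto
    qed
    ultimately have "finite (range (\<lambda>m'. va m' n))" by (rule finite_subset)
    moreover have "inj (\<lambda>m'. va m' n)" by (simp add: inj_def va_eq_iff)
    ultimately show False using finite_imageD infinite_UNIV_int by blast
  qed
  then show "vertex_sum u (va m n) = 0"
    using shift_invariant_imp_constant[of "\<lambda>m. vertex_sum u (va m n)", OF shift] by metis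
  then show "vertex_sum u (vb m n) = 0" by (simp add: ab)
qed

section \<open>Decomposition into hexagon functions\<close>

lemma sum_two_points:
  fixes c g :: "'a \<Rightarrow> 'k::comm_ring"
  assumes "finite {j. c j \<noteq> 0}" "a \<noteq> b" "\<And>j. j \<noteq> a \<Longrightarrow> j \<noteq> b \<Longrightarrow> g j = 0"
  shows "(\<Sum>j\<in>{j. c j \<noteq> 0}. c j * g j) = c a * g a + c b * g b"
proof -
  have "(\<Sum>j\<in>{j. c j \<noteq> 0}. c j * g j) = (\<Sum>j\<in>{j. c j \<noteq> 0} \<union> {a, b}. c j * g j)"
    using assms(1) by (intro sum.mono_neutral_left) auto
  also have "\<dots> = (\<Sum>j\<in>{a, b}. c j * g j)"
    using assms by (intro sum.mono_neutral_right) auto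
  finally show ?thesis using assms(2) by simp
qed

text \<open>
  The form has the components \<open>u (e0 m n)\<close>, \<open>- u (e1 m n)\<close> and \<open>u (e2 m n)\<close> on the steps
  \<open>(1, 0)\<close>, \<open>(0, 1)\<close> and \<open>(- 1, 1)\<close> from the tile \<open>(m, n)\<close>. The unit square
  at \<open>(m, n)\<close> consists of the triangles belonging to \<open>va m n\<close> and \<open>vb (m + 1) n\<close>, so subtracting
  these two vertex sums eliminates the diagonal and shows the form closed on the square lattice;
  then the vertex sum at \<open>va (m - 1) n\<close> gives back the diagonal component.
\<close>

theorem lemma5p4:
  fixes u :: "complex set \<Rightarrow> 'k::real_normed_field"
  assumes "u \<in> E6"
    and "finite {x \<in> honeycomb_edges. u x \<noteq> 0}"
  shows "\<exists>(J :: (int \<times> int) set) (c :: int \<times> int \<Rightarrow> 'k). finite J \<and>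
           (\<forall>x\<in>honeycomb_edges. u x = (\<Sum>j\<in>J. c j * of_real (psi j x)))"
proof -
  have eigen: "\<And>x. x \<in> honeycomb_edges \<Longrightarrow> - laplacian u x = 6 * u x"
    using assms(1) by (simp add: E6_def)
  note zero = vertex_sums_vanish[OF eigen assms(2)]
  have za: "u (e0 m n) + u (e1 m n) + u (e2 (m + 1) n) = 0" for m n
    using zero(1)[of m n] by (simp only: vertex_sum_va)
  have zb: "u (e1 m n) + u (e2 m n) + u (e0 (m - 1) (n + 1)) = 0" for m n
    using zero(2)[of m n] by (simp only: vertex_sum_vb)
  have finite_support: "finite {(m, n). u (f m n) \<noteq> 0}"
    if "\<And>m n. f m n \<in> honeycomb_edges" "\<And>m n m' n'. f m n = f m' n' \<longleftrightarrow> m = m' \<and> n = n'"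
    for f :: "int \<Rightarrow> int \<Rightarrow> complex set"
  proof (rule finite_imageD)
    show "finite ((\<lambda>(m, n). f m n) ` {(m, n). u (f m n) \<noteq> 0})"
      using assms(2) by (rule finite_subset[rotated]) (auto simp: that(1))
    show "inj_on (\<lambda>(m, n). f m n) {(m, n). u (f m n) \<noteq> 0}"
      by (auto simp: inj_on_def that(2))
  qed
  obtain c where fin: "finite {(m, n). c m n \<noteq> 0}"
    and c0: "\<And>m n. c m n - c (m + 1) n = u (e0 m n)"
    and c1: "\<And>m n. c m n - c m (n + 1) = - u (e1 m n)"
  proof (rule finitely_supported_potential)
    show "finite {(m, n). u (e0 m n) \<noteq> 0}"
      by (rule finite_support) (rule edge_mem edge_eq_simps)+
    show "finite {(m, n). - u (e1 m n) \<noteq> 0}"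
      unfolding neg_equal_0_iff_equal
      by (rule finite_support) (rule edge_mem edge_eq_simps)+
    show "u (e0 m n) + - u (e1 (m + 1) n) = - u (e1 m n) + u (e0 m (n + 1))" for m n
    proof -
      have h0: "u (e0 m n) = - u (e1 m n) - u (e2 (m + 1) n)"
        using za[of m n] by (simp add: algebra_simps eq_neg_iff_add_eq_0)
      have h1: "u (e0 m (n + 1)) = - u (e1 (m + 1) n) - u (e2 (m + 1) n)"
        using zb[of "m + 1" n] by (simp add: algebra_simps eq_neg_iff_add_eq_0)
      show ?thesis by (simp only: h0 h1) (simp add: algebra_simps)
    qed
  qed (rule that)
  have c2: "c m n - c (m - 1) (n + 1) = u (e2 m n)" for m n
  proof -
    have "u (e2 m n) = - u (e1 (m - 1) n) - u (e0 (m - 1) n)"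
      using za[of "m - 1" n] by (simp add: algebra_simps eq_neg_iff_add_eq_0)
    also have "\<dots> = (c (m - 1) n - c (m - 1) (n + 1)) - (c (m - 1) n - c m n)"
      using c0[of "m - 1" n] c1[of "m - 1" n] by simp
    finally show ?thesis by simp
  qed
  define C where "C = case_prod c"
  have finC: "finite {j. C j \<noteq> 0}"
    using fin by (simp add: C_def case_prod_unfold)
  have "u x = (\<Sum>j\<in>{j. C j \<noteq> 0}. C j * of_real (psi j x))" if x: "x \<in> honeycomb_edges" for x
  proof -
    from x obtain m n where "x = e0 m n \<or> x = e1 m n \<or> x = e2 m n"
      unfolding honeycomb_edges_normal_form by blast
    then show ?thesis
    proof (elim disjE)
      assume x: "x = e0 m n"
      show ?thesis unfolding x psi_edge
        by (subst sum_two_points[OF finC, of "(m, n)" "(m + 1, n)"])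
          (simp_all add: C_def flip: c0)
    next
      assume x: "x = e1 m n"
      have "u x = c m (n + 1) - c m n" unfolding x using arg_cong[OF c1[of m n], of uminus] by simp
      then show ?thesis unfolding x psi_edge
        by (subst sum_two_points[OF finC, of "(m, n)" "(m, n + 1)"]) (simp_all add: C_def)
    next
      assume x: "x = e2 m n"
      show ?thesis unfolding x psi_edge
        by (subst sum_two_points[OF finC, of "(m, n)" "(m - 1, n + 1)"])
          (simp_all add: C_def flip: c2)
    qed
  qed
  with finC show ?thesis by blast
qed

end
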